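(* Let $f=(f_1,\ldots,f_m)\colon\mathbb{R}^n\to\mathbb{R}^m$ be a polynomial map such that the section $[f(\mathbb{R}^n)]_t$ is bounded for all $t\in\mathbb{R}^m$. Then the problem $\mathrm{Min}_{\,\mathbb{R}^m_+}\{f(x)\mid x\in\mathbb{R}^n\}$ admits a Pareto solution, provided that one of the following equivalent conditions holds: (i) $f$ is proper; (ii) $f$ satisfies the Palais--Smale condition: $\widetilde K_\infty(f)=\emptyset$; (iii) $f$ satisfies the weak Palais--Smale condition: $K_\infty(f)=\emptyset$; (iv) $f$ is $M$-tame: $T_\infty(f)=\emptyset$.
   Context: $n,m\ge1$; $\mathbb{R}^m_+$ is the nonnegative orthant. A point $x^*\in\mathbb{R}^n$ is a Pareto solution of the problem if $f(x)\notin f(x^* )-(\mathbb{R}^m_+\setminus\{0\})$ for all $x\in\mathbb{R}^n$. For $A\subset\mathbb{R}^m$ and $t\in\mathbb{R}^m$, the section of $A$ at $t$ is $[A]_t:=A\cap(t-\mathbb{R}^m_+)$. It is called bounded if there is $a\in\mathbb{R}^m$ with $[A]_t\subset a+\mathbb{R}^m_+$. $f$ is proper at the sublevel $\bar t\in\mathbb{R}^m$ if for each compact subset $A\subset\bar t-\mathbb{R}^m_+$ the inverse image $f^{-1}(A)$ is compact; $f$ is proper if it is proper at every sublevel $\bar t\in\mathbb{R}^m$ (equivalently, preimages of compact subsets of $\mathbb{R}^m$ are compact). The Rabier function is $\nu_f(x):=\min_{\sum_{i=1}^m|\lambda_i|=1}\big\|\sum_{i=1}^m\lambda_i\nabla f_i(x)\big\|$.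 The tangency variety is $$\Gamma(f)=\Big\{x\in\mathbb{R}^n\ \Big|\ \exists\,\lambda_1,\ldots,\lambda_m,\mu\in\mathbb{R}\text{ not all zero with }\sum_{i=1}^m\lambda_i\nabla f_i(x)+\mu x=0\Big\}.$$ Define: $\widetilde K_\infty(f)$ = set of $t\in\mathbb{R}^m$ for which there is a sequence $\{x^k\}\subset\mathbb{R}^n$ with $\|x^k\|\to+\infty$, $f(x^k)\to t$ and $\nu_f(x^k)\to0$ as $k\to\infty$; $K_\infty(f)$ = set of $t\in\mathbb{R}^m$ for which there is a sequence $\{x^k\}\subset\mathbb{R}^n$ with $\|x^k\|\to+\infty$, $f(x^k)\to t$ and $\|x^k\|\nu_f(x^k)\to0$ as $k\to\infty$; $T_\infty(f)$ = set of $t\in\mathbb{R}^m$ for which there is a sequence $\{x^k\}\subset\Gamma(f)$ with $\|x^k\|\to+\infty$ and $f(x^k)\to t$ as $k\to\infty$. *)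

theory Defs
  imports "HOL-Analysis.Analysis"
begin

definition nonneg_orthant :: "(real ^ 'm) set" where
  "nonneg_orthant = {y. \<forall>i. 0 \<le> y $ i}"

text \<open>The problem is the unconstrained one, minimising \<open>f\<close> over the whole space with respect to
  the cone \<^const>\<open>nonneg_orthant\<close>.\<close>

definition pareto_solution :: "(real ^ 'n \<Rightarrow> real ^ 'm) \<Rightarrow> real ^ 'n \<Rightarrow> bool" where
  "pareto_solution f xs \<longleftrightarrow> (\<forall>x. f x \<notin> (\<lambda>v. f xs - v) ` (nonneg_orthant - {0}))"

definition lower_orthant :: "real ^ 'm \<Rightarrow> (real ^ 'm) set" where
  "lower_orthant t = (\<lambda>v. t - v) ` nonneg_orthant"

definition section_at :: "(real ^ 'm) set \<Rightarrow> real ^ 'm \<Rightarrow> (real ^ 'm) set" where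
  "section_at A t = A \<inter> lower_orthant t"

text \<open>Boundedness of a section only asks for a lower bound; the upper bound is built in.\<close>

definition bounded_section_at :: "(real ^ 'm) set \<Rightarrow> real ^ 'm \<Rightarrow> bool" where
  "bounded_section_at A t \<longleftrightarrow> (\<exists>a. section_at A t \<subseteq> (\<lambda>v. a + v) ` nonneg_orthant)"

definition proper_at_sublevel :: "(real ^ 'n \<Rightarrow> real ^ 'm) \<Rightarrow> real ^ 'm \<Rightarrow> bool" where
  "proper_at_sublevel f t \<longleftrightarrow> (\<forall>A. compact A \<and> A \<subseteq> lower_orthant t \<longrightarrow> compact (f -` A))"

definition is_proper :: "(real ^ 'n \<Rightarrow> real ^ 'm) \<Rightarrow> bool" where
  "is_proper f \<longleftrightarrow> (\<forall>t. proper_at_sublevel f t)"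

definition gradient :: "(real ^ 'n \<Rightarrow> real) \<Rightarrow> real ^ 'n \<Rightarrow> real ^ 'n" where
  "gradient g x = (THE D. GDERIV g x :> D)"

definition gradient_combination ::
    "(real ^ 'n \<Rightarrow> real ^ 'm) \<Rightarrow> real ^ 'm \<Rightarrow> real ^ 'n \<Rightarrow> real ^ 'n" where
  "gradient_combination f c x = (\<Sum>i\<in>UNIV. c $ i *\<^sub>R gradient (\<lambda>y. f y $ i) x)"

text \<open>The infimum is a minimum, see \<open>rabier_attained\<close> below.\<close>

definition rabier :: "(real ^ 'n \<Rightarrow> real ^ 'm) \<Rightarrow> real ^ 'n \<Rightarrow> real" where
  "rabier f x = (INF c\<in>{c. (\<Sum>i\<in>UNIV. \<bar>c $ i\<bar>) = 1}. norm (gradient_combination f c x))"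

definition tangency_variety :: "(real ^ 'n \<Rightarrow> real ^ 'm) \<Rightarrow> (real ^ 'n) set" where
  "tangency_variety f =
    {x. \<exists>c \<mu>. \<not> (c = 0 \<and> \<mu> = 0) \<and> gradient_combination f c x + \<mu> *\<^sub>R x = 0}"

definition K_tilde_inf :: "(real ^ 'n \<Rightarrow> real ^ 'm) \<Rightarrow> (real ^ 'm) set" where
  "K_tilde_inf f = {t. \<exists>X :: nat \<Rightarrow> real ^ 'n.
     filterlim (\<lambda>k. norm (X k)) at_top sequentially \<and>
     (\<lambda>k. f (X k)) \<longlonglongrightarrow> t \<and> (\<lambda>k. rabier f (X k)) \<longlonglongrightarrow> 0}"

definition K_inf :: "(real ^ 'n \<Rightarrow> real ^ 'm) \<Rightarrow> (real ^ 'm) set" where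
  "K_inf f = {t. \<exists>X :: nat \<Rightarrow> real ^ 'n.
     filterlim (\<lambda>k. norm (X k)) at_top sequentially \<and>
     (\<lambda>k. f (X k)) \<longlonglongrightarrow> t \<and> (\<lambda>k. norm (X k) * rabier f (X k)) \<longlonglongrightarrow> 0}"

definition T_inf :: "(real ^ 'n \<Rightarrow> real ^ 'm) \<Rightarrow> (real ^ 'm) set" where
  "T_inf f = {t. \<exists>X :: nat \<Rightarrow> real ^ 'n.
     (\<forall>k. X k \<in> tangency_variety f) \<and>
     filterlim (\<lambda>k. norm (X k)) at_top sequentially \<and> (\<lambda>k. f (X k)) \<longlonglongrightarrow> t}"

definition palais_smale :: "(real ^ 'n \<Rightarrow> real ^ 'm) \<Rightarrow> bool" where
  "palais_smale f \<longleftrightarrow> K_tilde_inf f = {}"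

definition weak_palais_smale :: "(real ^ 'n \<Rightarrow> real ^ 'm) \<Rightarrow> bool" where
  "weak_palais_smale f \<longleftrightarrow> K_inf f = {}"

definition M_tame :: "(real ^ 'n \<Rightarrow> real ^ 'm) \<Rightarrow> bool" where
  "M_tame f \<longleftrightarrow> T_inf f = {}"

lemma gradient_eqI:
  assumes "GDERIV g x :> D"
  shows "gradient g x = D"
  unfolding gradient_def
proof (rule the_equality)
  fix E assume "GDERIV g x :> E"
  with assms have "(\<lambda>h. h \<bullet> E) = (\<lambda>h. h \<bullet> D)"
    unfolding gderiv_def by (blast intro: has_derivative_unique)
  then show "E = D"
    by (simp add: fun_eq_iff vector_eq_ldot)
qed (rule assms)

lemma GDERIV_gradient:
  fixes g :: "real ^ 'n \<Rightarrow> real"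
  assumes "g differentiable (at x)"
  shows "GDERIV g x :> gradient g x"
proof -
  obtain g' where g': "(g has_derivative g') (at x)"
    using assms by (auto simp: differentiable_def)
  then interpret bounded_linear g' by (rule has_derivative_bounded_linear)
  have "g' h = h \<bullet> adjoint g' 1" for h
    using adjoint_works[OF linear_axioms, of h 1] by simp
  then have "g' = (\<lambda>h. h \<bullet> adjoint g' 1)" by (rule ext)
  with g' have "GDERIV g x :> adjoint g' 1" by (simp add: gderiv_def)
  then show ?thesis by (simp add: gradient_eqI)
qed

lemma rabier_attained:
  fixes f :: "real ^ 'n \<Rightarrow> real ^ 'm"
  obtains c where "(\<Sum>i\<in>UNIV. \<bar>c $ i\<bar>) = 1" and "rabier f x = norm (gradient_combination f c x)"
    and "\<And>d. (\<Sum>i\<in>UNIV. \<bar>d $ i\<bar>) = 1 \<Longrightarrow>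
      norm (gradient_combination f c x) \<le> norm (gradient_combination f d x)"
proof -
  let ?S = "{c :: real ^ 'm. (\<Sum>i\<in>UNIV. \<bar>c $ i\<bar>) = 1}"
  let ?F = "\<lambda>c. norm (gradient_combination f c x)"
  have "closed ?S"
    by (intro closed_Collect_eq continuous_intros)
  moreover have "bounded ?S"
  proof (rule boundedI)
    fix c assume "c \<in> ?S"
    then show "norm c \<le> 1" using norm_le_l1_cart[of c] by simp
  qed
  ultimately have "compact ?S" by (simp add: compact_eq_bounded_closed)
  moreover have "axis undefined 1 \<in> ?S"
  proof -
    have "\<bar>axis undefined (1::real) $ i\<bar> = (if i = undefined then 1 else 0)" for i :: 'm
      by (simp add: axis_def)
    then show ?thesis by simp
  qed
  moreover have "continuous_on ?S ?F"
    unfolding gradient_combination_def by (intro continuous_intros)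
  ultimately obtain c where c: "c \<in> ?S" "\<And>d. d \<in> ?S \<Longrightarrow> ?F c \<le> ?F d"
    using continuous_attains_inf[of ?S ?F] by blast
  then have "rabier f x = ?F c"
    unfolding rabier_def by (intro cInf_eq_minimum) auto
  then show thesis using c by (intro that[of c]) auto
qed

end

theory Submission
  imports Defs
begin

text \<open>
  Scalarise by the largest component \<open>\<phi> = max f\<^sub>i\<close>; \<open>f\<close> is proper once the sublevel sets of \<open>\<phi>\<close> are
  bounded. If they are not, minimise \<open>\<phi>\<close> on spheres through points of an unbounded sublevel set:
  the minimisers lie in the tangency variety, and bounded sections make their values subconverge,
  so \<open>f\<close> is not M-tame. For the Palais-Smale conditions, let \<open>\<alpha>\<close> be the infimum of the levels with
  unbounded sublevel set. Near a far point with \<open>\<phi> \<le> \<alpha> + \<epsilon>\<close>, add to \<open>\<phi>\<close> a quadratic penalty on a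
  ball of radius \<open>\<rho>\<close> comparable to the distance from the origin; as \<open>\<phi> > \<alpha> - \<epsilon>\<close> on that ball, the
  minimum is interior, and there the Rabier function is \<open>O(\<epsilon> / \<rho>)\<close>. In both cases Gordan's
  alternative turns minimality of a maximum into a vanishing convex combination of gradients.
\<close>

section \<open>The orthant and its sections in terms of the componentwise order\<close>

lemma nonneg_orthant_eq: "nonneg_orthant = {0..}"
  by (auto simp: nonneg_orthant_def less_eq_vec_def)

lemma lower_orthant_eq: "lower_orthant t = {..t}"
proof -
  have "x \<in> (\<lambda>v. t - v) ` {0..}" if "x \<le> t" for x
    using that by (intro image_eqI[of _ _ "t - x"]) (auto simp: less_eq_vec_def)
  then show ?thesis
    by (auto simp: lower_orthant_def nonneg_orthant_eq less_eq_vec_def)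
qed

lemma bounded_section_at_iff:
  "bounded_section_at A t \<longleftrightarrow> (\<exists>a. \<forall>y\<in>A. y \<le> t \<longrightarrow> a \<le> y)"
proof -
  have "(\<lambda>v. a + v) ` nonneg_orthant = {a..}" for a :: "real ^ 'a"
  proof -
    have "x \<in> (\<lambda>v. a + v) ` {0..}" if "a \<le> x" for x
      using that by (intro image_eqI[of _ _ "x - a"]) (auto simp: less_eq_vec_def)
    then show ?thesis
      by (auto simp: nonneg_orthant_eq less_eq_vec_def)
  qed
  then show ?thesis
    by (auto simp: bounded_section_at_def section_at_def lower_orthant_eq subset_iff)
qed

lemma pareto_solutionI:
  assumes "\<And>x. \<not> f x < f xs"
  shows "pareto_solution f xs"
  unfolding pareto_solution_def
proof (intro allI notI)
  fix x assume "f x \<in> (\<lambda>v. f xs - v) ` (nonneg_orthant - {0})"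
  then obtain v where v: "f x = f xs - v" "0 \<le> v" "v \<noteq> 0"
    by (auto simp: nonneg_orthant_eq)
  then have "f x \<le> f xs" "f x \<noteq> f xs"
    by (auto simp: less_eq_vec_def)
  then show False using assms[of x] by auto
qed

section \<open>Gordan's alternative and common descent directions\<close>

text \<open>The image of the standard simplex under the linear map with values \<open>g i\<close> at
  the vertices is compact and convex. Either it contains 0, or a hyperplane strictly separates it
  from 0 and the normal serves as \<open>v\<close>.\<close>

lemma Gordan_alternative:
  fixes g :: "'m::finite \<Rightarrow> 'a::euclidean_space"
  obtains (combination) c :: "real ^ 'm"
    where "\<And>i. 0 \<le> c $ i" "(\<Sum>i\<in>UNIV. c $ i) = 1" "(\<Sum>i\<in>UNIV. c $ i *\<^sub>R g i) = 0"
  | (direction) v where "\<And>i. 0 < v \<bullet> g i"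
proof -
  define C where "C = {c :: real ^ 'm. (\<forall>i. 0 \<le> c $ i) \<and> (\<Sum>i\<in>UNIV. c $ i) = 1}"
  define L where "L c = (\<Sum>i\<in>UNIV. c $ i *\<^sub>R g i)" for c :: "real ^ 'm"
  have lin: "linear L"
    by (rule linearI) (auto simp: L_def scaleR_add_left sum.distrib scaleR_right.sum)
  have "closed C"
    unfolding C_def
    by (intro closed_Collect_conj closed_Collect_all closed_Collect_le closed_Collect_eq
        continuous_intros)
  moreover have "bounded C"
  proof (rule boundedI)
    fix c assume "c \<in> C"
    then show "norm c \<le> 1" using norm_le_l1_cart[of c] by (simp add: C_def)
  qed
  ultimately have "compact C" by (simp add: compact_eq_bounded_closed)
  then have "closed (L ` C)"
    by (intro compact_imp_closed compact_continuous_image linear_continuous_on lin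
        linear_conv_bounded_linear[THEN iffD1])
  moreover have "convex C"
    by (auto simp: convex_def C_def sum.distrib simp flip: sum_distrib_left)
  then have "convex (L ` C)" by (rule convex_linear_image[OF lin])
  ultimately consider "0 \<in> L ` C" | v b where "0 < b" "\<And>y. y \<in> L ` C \<Longrightarrow> b < v \<bullet> y"
    using separating_hyperplane_closed_0 by metis
  then show thesis
  proof cases
    case 1
    then obtain c where "c \<in> C" "L c = 0" by force
    then show thesis using combination[of c] by (simp add: C_def L_def)
  next
    case 2
    \<comment> \<open>The vertices of the simplex are mapped to the vectors \<open>g i\<close>, so
      the separating normal is positive on each of them.\<close>
    have "g i \<in> L ` C" for i
    proof (rule image_eqI)
      show "axis i 1 \<in> C" by (simp add: C_def axis_def)
      show "g i = L (axis i 1)"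
        by (simp add: L_def axis_def if_distrib[of "\<lambda>r. r *\<^sub>R _"] cong: if_cong)
    qed
    then show thesis using 2 direction by (meson less_trans)
  qed
qed

text \<open>By the chain rule each component has derivative \<open>v \<bullet> g i\<close> along the
  curve, and finitely many one-sided neighbourhoods have a common one. A curve is allowed instead of
  a line so that descent can stay on a sphere.\<close>

lemma simultaneous_descent:
  fixes F :: "'a::real_inner \<Rightarrow> real ^ 'm"
  assumes "\<And>i. GDERIV (\<lambda>y. F y $ i) (\<gamma> 0) :> g i"
    and "(\<gamma> has_vector_derivative v) (at 0)"
    and "\<And>i. v \<bullet> g i < 0"
  shows "\<forall>\<^sub>F s in at_right 0. \<forall>i. F (\<gamma> s) $ i < F (\<gamma> 0) $ i"
proof (rule eventually_all_finite)
  fix i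
  have "((\<lambda>s. F (\<gamma> s) $ i) has_derivative (\<lambda>h. (h *\<^sub>R v) \<bullet> g i)) (at 0)"
    using has_derivative_compose[OF assms(2)[unfolded has_vector_derivative_def]
        assms(1)[of i, unfolded gderiv_def]] .
  then have "((\<lambda>s. F (\<gamma> s) $ i) has_real_derivative (v \<bullet> g i)) (at 0)"
    by (simp add: has_field_derivative_def mult.commute[of _ "v \<bullet> g i"])
  from DERIV_neg_dec_right[OF this assms(3)]
  obtain d where "d > 0" "\<And>h. h > 0 \<Longrightarrow> h < d \<Longrightarrow> F (\<gamma> h) $ i < F (\<gamma> 0) $ i"
    by auto
  then show "\<forall>\<^sub>F s in at_right 0. F (\<gamma> s) $ i < F (\<gamma> 0) $ i"
    unfolding eventually_at_right_field by blast
qed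

section \<open>The scalarisation by the largest component\<close>

definition max_comp :: "('a \<Rightarrow> real ^ 'm) \<Rightarrow> 'a \<Rightarrow> real" where
  "max_comp f x = Max (range (\<lambda>i. f x $ i))"

lemma max_comp_le_iff: "max_comp f x \<le> s \<longleftrightarrow> (\<forall>i. f x $ i \<le> s)"
  by (simp add: max_comp_def)

lemma max_comp_less_iff: "max_comp f x < s \<longleftrightarrow> (\<forall>i. f x $ i < s)"
  by (simp add: max_comp_def)

lemma comp_le_max_comp: "f x $ i \<le> max_comp f x"
  by (simp add: max_comp_def)

lemma continuous_on_max_comp:
  fixes f :: "'a::topological_space \<Rightarrow> real ^ 'm"
  assumes "continuous_on S f"
  shows "continuous_on S (max_comp f)"
proof -
  have "continuous_on S (\<lambda>x. Max ((\<lambda>i. f x $ i) ` I))" if "finite I" "I \<noteq> {}" for I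
    using that
  proof (induction I rule: finite_ne_induct)
    case (singleton i)
    then show ?case using assms by (simp add: continuous_on_component)
  next
    case (insert i I)
    then show ?case using assms by (simp add: continuous_on_component continuous_on_max)
  qed
  then show ?thesis by (simp add: max_comp_def[abs_def])
qed

section \<open>First-order conditions at minimisers of the scalarisation\<close>

lemma rabier_le:
  assumes "(\<Sum>i\<in>UNIV. \<bar>c $ i\<bar>) = 1"
  shows "rabier f x \<le> norm (gradient_combination f c x)"
  unfolding rabier_def using assms by (intro cINF_lower bdd_belowI2[of _ 0]) auto

lemma rabier_nonneg: "0 \<le> rabier f x"
  by (rule rabier_attained[of f x]) simp

lemma GDERIV_component:
  fixes f :: "real ^ 'n \<Rightarrow> real ^ 'm"
  assumes "f differentiable (at x)"
  shows "GDERIV (\<lambda>y. f y $ i) x :> gradient (\<lambda>y. f y $ i) x"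
proof (rule GDERIV_gradient)
  show "(\<lambda>y. f y $ i) differentiable (at x)"
    using assms bounded_linear.has_derivative[OF bounded_linear_vec_nth]
    unfolding differentiable_def by blast
qed

text \<open>Gordan's alternative for the vectors \<open>g i + p\<close> leaves two cases. A
  vanishing convex combination yields one of the gradients equal to \<open>- p\<close>, since the
  weights sum to 1, and these weights are admissible for \<open>rabier\<close>. The other case gives
  a descent direction, contradicting minimality.\<close>

lemma rabier_le_penalty:
  fixes f :: "real ^ 'n \<Rightarrow> real ^ 'm"
  assumes diff: "f differentiable (at y)" and q: "GDERIV q y :> p"
    and "0 < d" and min: "\<And>z. dist z y < d \<Longrightarrow> max_comp f y + q y \<le> max_comp f z + q z"
  shows "rabier f y \<le> norm p"
proof -
  define g where "g i = gradient (\<lambda>z. f z $ i) y" for i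
  have g: "GDERIV (\<lambda>z. f z $ i) y :> g i" for i
    unfolding g_def using diff by (rule GDERIV_component)
  show ?thesis
  proof (cases rule: Gordan_alternative[of "\<lambda>i. g i + p"])
    case (combination c)
    have "gradient_combination f c y + p = (\<Sum>i\<in>UNIV. c $ i *\<^sub>R g i) + (\<Sum>i\<in>UNIV. c $ i) *\<^sub>R p"
      using combination(2) by (simp add: gradient_combination_def g_def)
    also have "\<dots> = 0"
      using combination(3) by (simp only: scaleR_add_right sum.distrib scaleR_left.sum)
    finally have "norm (gradient_combination f c y) = norm p"
      by (simp flip: eq_neg_iff_add_eq_0)
    moreover have "(\<Sum>i\<in>UNIV. \<bar>c $ i\<bar>) = 1" using combination by simp
    ultimately show ?thesis using rabier_le[of c f y] by simp
  next
    case (direction v)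
    \<comment> \<open>Adding the penalty to every component adds it to the maximum, so descent in
      all components of \<open>F\<close> lowers the penalised objective.\<close>
    define F where "F z = (\<chi> i. f z $ i + q z)" for z
    have F': "GDERIV (\<lambda>z. F z $ i) y :> g i + p" for i
      unfolding F_def using GDERIV_add[OF g q] by simp
    have "((\<lambda>s. y + s *\<^sub>R (- v)) has_vector_derivative - v) (at 0)"
      by (auto intro!: derivative_eq_intros)
    then have "\<forall>\<^sub>F s in at_right 0.
        \<forall>i. F (y + s *\<^sub>R (- v)) $ i < F (y + 0 *\<^sub>R (- v)) $ i"
    proof (rule simultaneous_descent[where \<gamma> = "\<lambda>s. y + s *\<^sub>R (- v)", rotated])
      show "GDERIV (\<lambda>z. F z $ i) (y + 0 *\<^sub>R (- v)) :> g i + p" for i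
        using F' by simp
      show "- v \<bullet> (g i + p) < 0" for i
        using direction[of i] by simp
    qed
    moreover have "((\<lambda>s. y + s *\<^sub>R (- v)) \<longlongrightarrow> y + 0 *\<^sub>R (- v)) (at_right 0)"
      by (intro tendsto_intros)
    from tendstoD[OF this \<open>0 < d\<close>]
    have "\<forall>\<^sub>F s in at_right 0. dist (y + s *\<^sub>R (- v)) y < d" by simp
    ultimately have "\<forall>\<^sub>F s :: real in at_right 0. False"
    proof eventually_elim
      case (elim s)
      have "f (y + s *\<^sub>R (- v)) $ i < max_comp f y + q y - q (y + s *\<^sub>R (- v))" for i
      proof -
        have "f (y + s *\<^sub>R (- v)) $ i + q (y + s *\<^sub>R (- v)) < f y $ i + q y"
          using elim(1) by (simp add: F_def)
        then show ?thesis using comp_le_max_comp[of f y i] by linarith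
      qed
      then have "max_comp f (y + s *\<^sub>R (- v)) < max_comp f y + q y - q (y + s *\<^sub>R (- v))"
        by (simp add: max_comp_less_iff)
      then show False using min[OF elim(2)] by simp
    qed
    then show ?thesis by simp
  qed
qed

text \<open>A Lagrange multiplier rule for a maximum of functions on a sphere: if no convex
  combination of gradients is normal to the sphere, a tangent direction lowers all components at
  once.\<close>

lemma sphere_min_in_tangency_variety:
  fixes f :: "real ^ 'n \<Rightarrow> real ^ 'm"
  assumes diff: "f differentiable (at y)" and "y \<noteq> 0"
    and min: "\<And>z. norm z = norm y \<Longrightarrow> max_comp f y \<le> max_comp f z"
  shows "y \<in> tangency_variety f"
proof -
  define g where "g i = gradient (\<lambda>z. f z $ i) y" for i
  have g: "GDERIV (\<lambda>z. f z $ i) y :> g i" for i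
    unfolding g_def using diff by (rule GDERIV_component)
  \<comment> \<open>Gordan's alternative is applied to the gradients projected to the tangent space of the sphere.\<close>
  define P where "P u = u - ((u \<bullet> y) / (y \<bullet> y)) *\<^sub>R y" for u
  have P_orth: "P u \<bullet> y = 0" for u
    using \<open>y \<noteq> 0\<close> by (simp add: P_def inner_diff_left)
  have P_adj: "P u \<bullet> w = u \<bullet> P w" for u w
    by (simp add: P_def inner_diff_left inner_diff_right inner_commute)
  show ?thesis
  proof (cases rule: Gordan_alternative[of "\<lambda>i. P (g i)"])
    case (combination c)
    \<comment> \<open>The multiplier collects the multiples of \<open>y\<close> that the projection
      \<open>P\<close> removes from the gradients.\<close>
    let ?\<mu> = "- (\<Sum>i\<in>UNIV. c $ i * ((g i \<bullet> y) / (y \<bullet> y)))"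
    have "gradient_combination f c y + ?\<mu> *\<^sub>R y = 0"
      using combination(3)
      by (simp add: P_def gradient_combination_def g_def scaleR_diff_right sum_subtractf
          scaleR_left.sum)
    moreover have "c \<noteq> 0" using combination(2) by auto
    ultimately show ?thesis unfolding tangency_variety_def by blast
  next
    case (direction w)
    \<comment> \<open>Projecting makes the direction tangent, and self-adjointness of
      \<open>P\<close> moves the projection onto the gradients, where the alternative
      applies.\<close>
    define v where "v = - P w"
    have v: "v \<bullet> g i < 0" "v \<bullet> y = 0" for i
      using direction[of i] P_orth[of w] by (simp_all add: v_def flip: P_adj)
    \<comment> \<open>The tangent line is scaled back radially to the sphere. It never meets 0,
      because its inner product with \<open>y\<close> is constant.\<close>
    define \<gamma> where "\<gamma> s = (norm y / norm (y + s *\<^sub>R v)) *\<^sub>R (y + s *\<^sub>R v)" for s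
    have nz: "y + s *\<^sub>R v \<noteq> 0" for s
    proof
      assume "y + s *\<^sub>R v = 0"
      then have "(y + s *\<^sub>R v) \<bullet> y = 0" by simp
      then show False using v(2) \<open>y \<noteq> 0\<close> by (simp add: inner_add_left)
    qed
    have norm_\<gamma>: "norm (\<gamma> s) = norm y" for s
      using nz[of s] by (simp add: \<gamma>_def)
    have \<gamma>0: "\<gamma> 0 = y" using \<open>y \<noteq> 0\<close> by (simp add: \<gamma>_def)
    have "((\<lambda>s. y + s *\<^sub>R v) has_derivative (\<lambda>h. h *\<^sub>R v)) (at 0)"
      by (auto intro!: derivative_eq_intros)
    then have "((\<lambda>s. norm (y + s *\<^sub>R v)) has_derivative (\<lambda>h. (h *\<^sub>R v) \<bullet> sgn y)) (at 0)"
      using has_derivative_compose[OF _ has_derivative_norm] \<open>y \<noteq> 0\<close> by fastforce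
    \<comment> \<open>As \<open>v\<close> is orthogonal to \<open>y\<close>, the scaling factor is
      stationary at 0, so the scaled curve still has velocity \<open>v\<close> there.\<close>
    then have "((\<lambda>s. norm (y + s *\<^sub>R v)) has_real_derivative 0) (at 0)"
      using v(2) by (simp add: has_field_derivative_def sgn_div_norm lambda_zero)
    then have "((\<lambda>s. norm y / norm (y + s *\<^sub>R v)) has_real_derivative 0) (at 0)"
      using \<open>y \<noteq> 0\<close> by (auto intro!: derivative_eq_intros)
    moreover have "((\<lambda>s. y + s *\<^sub>R v) has_vector_derivative v) (at 0)"
      by (auto intro!: derivative_eq_intros)
    ultimately have "(\<gamma> has_vector_derivative v) (at 0)"
      unfolding \<gamma>_def using has_vector_derivative_scaleR \<open>y \<noteq> 0\<close> by fastforce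
    then have "\<forall>\<^sub>F s in at_right 0. \<forall>i. f (\<gamma> s) $ i < f y $ i"
      using simultaneous_descent[of f \<gamma> g v] g v \<gamma>0 by simp
    then have "\<forall>\<^sub>F s :: real in at_right 0. False"
    proof eventually_elim
      case (elim s)
      have "f (\<gamma> s) $ i < max_comp f y" for i
        using elim[rule_format, of i] comp_le_max_comp[of f y i] by (rule less_le_trans)
      then have "max_comp f (\<gamma> s) < max_comp f y" by (simp add: max_comp_less_iff)
      then show False using min[OF norm_\<gamma>, of s] by simp
    qed
    then show ?thesis by simp
  qed
qed

section \<open>Consequences of properness\<close>

text \<open>Every compact set is bounded and hence lies below some constant vector
  \<open>vec B\<close>, so it is among the sets tested by properness at that sublevel.\<close>

lemma proper_preimage_compact:
  assumes "is_proper f" "compact A"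
  shows "compact (f -` A)"
proof -
  obtain B where B: "\<And>y. y \<in> A \<Longrightarrow> norm y \<le> B"
    using compact_imp_bounded[OF \<open>compact A\<close>] by (auto simp: bounded_iff)
  have "A \<subseteq> lower_orthant (vec B)"
  proof
    fix y assume "y \<in> A"
    then have "y $ i \<le> B" for i
      using B[of y] component_le_norm_cart[of y i] by linarith
    then show "y \<in> lower_orthant (vec B)" by (simp add: lower_orthant_eq less_eq_vec_def)
  qed
  then show ?thesis
    using assms by (auto simp: is_proper_def proper_at_sublevel_def)
qed

text \<open>A convergent sequence of values together with its limit is compact, so its preimage
  would be a bounded set containing all \<open>X k\<close>.\<close>

lemma proper_not_convergent_at_infinity:
  fixes X :: "nat \<Rightarrow> real ^ 'n"
  assumes "is_proper f" "filterlim (\<lambda>k. norm (X k)) at_top sequentially"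
  shows "\<not> (\<lambda>k. f (X k)) \<longlonglongrightarrow> t"
proof
  assume "(\<lambda>k. f (X k)) \<longlonglongrightarrow> t"
  then have "compact (f -` insert t (range (\<lambda>k. f (X k))))"
    by (intro proper_preimage_compact compact_sequence_with_limit assms(1))
  then obtain B where "\<forall>x\<in>f -` insert t (range (\<lambda>k. f (X k))). norm x \<le> B"
    using compact_imp_bounded bounded_iff by blast
  then have "norm (X k) \<le> B" for k by blast
  moreover have "\<forall>\<^sub>F k in sequentially. B < norm (X k)"
    using assms(2) by (simp add: filterlim_at_top_dense)
  then obtain k where "B < norm (X k)"
    by (auto simp: eventually_sequentially)
  ultimately show False by (meson not_less)
qed

lemma proper_imp_no_asymptotic_values:
  assumes "is_proper f"
  shows "K_tilde_inf f = {}" "K_inf f = {}" "T_inf f = {}"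
  using proper_not_convergent_at_infinity[OF assms]
  by (auto simp: K_tilde_inf_def K_inf_def T_inf_def)

lemma K_inf_subset_K_tilde_inf: "K_inf f \<subseteq> K_tilde_inf f"
proof
  fix t assume "t \<in> K_inf f"
  then obtain X where X: "filterlim (\<lambda>k. norm (X k)) at_top sequentially"
    "(\<lambda>k. f (X k)) \<longlonglongrightarrow> t" "(\<lambda>k. norm (X k) * rabier f (X k)) \<longlonglongrightarrow> 0"
    by (auto simp: K_inf_def)
  have "\<forall>\<^sub>F k in sequentially. 1 \<le> norm (X k)"
    using X(1) by (simp add: filterlim_at_top)
  then have "\<forall>\<^sub>F k in sequentially. rabier f (X k) \<le> norm (X k) * rabier f (X k)"
    by eventually_elim (use mult_right_mono[OF _ rabier_nonneg] in fastforce)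
  then have "(\<lambda>k. rabier f (X k)) \<longlonglongrightarrow> 0"
    by (rule tendsto_sandwich[OF always_eventually _ tendsto_const X(3), rotated])
      (simp add: rabier_nonneg)
  with X show "t \<in> K_tilde_inf f" by (auto simp: K_tilde_inf_def)
qed

text \<open>The sum of the components is minimised over the preimage of the box between the lower
  bound \<open>a\<close> of the section at \<open>f 0\<close> and \<open>f 0\<close> itself. A point
  dominating the minimiser would again lie in this preimage and have a smaller sum.\<close>

lemma proper_ex_pareto_solution:
  fixes f :: "real ^ 'n \<Rightarrow> real ^ 'm"
  assumes "is_proper f" "continuous_on UNIV f" "\<forall>t. bounded_section_at (range f) t"
  shows "\<exists>x. pareto_solution f x"
proof -
  obtain a where a: "\<And>x. f x \<le> f 0 \<Longrightarrow> a \<le> f x"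
    using assms(3) by (auto simp: bounded_section_at_iff)
  let ?K = "f -` {a..f 0}"
  have "compact ?K"
    by (intro proper_preimage_compact assms(1)) (simp add: interval_cbox_cart)
  moreover have "0 \<in> ?K" using a by simp
  moreover have "continuous_on ?K (\<lambda>x. \<Sum>i\<in>UNIV. f x $ i)"
    using assms(2) by (intro continuous_intros) (auto intro: continuous_on_subset)
  ultimately obtain xs where xs: "xs \<in> ?K"
    "\<And>x. x \<in> ?K \<Longrightarrow> (\<Sum>i\<in>UNIV. f xs $ i) \<le> (\<Sum>i\<in>UNIV. f x $ i)"
    using continuous_attains_inf[of ?K] by blast
  have "\<not> f x < f xs" for x
  proof
    assume less: "f x < f xs"
    then have "f x \<le> f 0" using xs(1) by auto
    then have "x \<in> ?K" using a by simp
    moreover have "(\<Sum>i\<in>UNIV. f x $ i) < (\<Sum>i\<in>UNIV. f xs $ i)"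
      using less by (intro sum_strict_mono_ex1)
        (auto simp: less_vec_def less_eq_vec_def not_le)
    ultimately show False using xs(2)[of x] by simp
  qed
  then show ?thesis using pareto_solutionI by blast
qed

section \<open>Unbounded sublevel sets and the tangency variety at infinity\<close>

text \<open>The bound on the largest component puts the values below \<open>vec s\<close>; the
  bounded section there supplies a lower bound, so they stay in a compact box.\<close>

lemma convergent_subsequence_of_bounded_max_comp:
  fixes f :: "'a \<Rightarrow> real ^ 'm" and X :: "nat \<Rightarrow> 'a"
  assumes "\<forall>t. bounded_section_at (range f) t" "\<And>k. max_comp f (X k) \<le> s"
  obtains r t where "strict_mono r" "(\<lambda>k. f (X (r k))) \<longlonglongrightarrow> t"
proof -
  obtain a where a: "\<And>x. f x \<le> vec s \<Longrightarrow> a \<le> f x"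
    using assms(1) by (auto simp: bounded_section_at_iff)
  have "f (X k) \<le> vec s" for k
    using assms(2)[of k] by (simp add: max_comp_le_iff less_eq_vec_def)
  then have "range (\<lambda>k. f (X k)) \<subseteq> cbox a (vec s)"
    using a by (auto simp flip: interval_cbox_cart)
  then have "bounded (range (\<lambda>k. f (X k)))"
    using bounded_cbox bounded_subset by blast
  from bounded_imp_convergent_subsequence[OF this] show thesis
    using that by (auto simp: o_def)
qed

lemma filterlim_subseq_of_norm_ge:
  assumes "\<And>k. real k \<le> norm (X k)" "strict_mono r"
  shows "filterlim (\<lambda>k. norm (X (r k))) at_top sequentially"
  using filterlim_real_sequentially
proof (rule filterlim_at_top_mono, intro always_eventually allI)
  fix k
  show "real k \<le> norm (X (r k))"
    using assms(1)[of "r k"] seq_suble[OF assms(2), of k] by linarith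
qed

lemma unbounded_sublevel_of_not_proper:
  fixes f :: "real ^ 'n \<Rightarrow> real ^ 'm"
  assumes "continuous_on UNIV f" "\<not> is_proper f"
  obtains s where "\<not> bounded {x. max_comp f x \<le> s}"
proof -
  obtain t A where A: "compact A" "A \<subseteq> {..t}" "\<not> compact (f -` A)"
    using assms(2) by (auto simp: is_proper_def proper_at_sublevel_def lower_orthant_eq)
  have "closed (f -` A)"
    using closed_vimage[OF compact_imp_closed[OF A(1)] assms(1)] .
  then have "\<not> bounded (f -` A)"
    using A(3) by (simp add: compact_eq_bounded_closed)
  \<comment> \<open>\<open>max_comp id t\<close> is the largest coordinate of
    \<open>t\<close>.\<close>
  moreover have "f -` A \<subseteq> {x. max_comp f x \<le> max_comp id t}"
  proof clarsimp
    fix x assume "f x \<in> A"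
    then have "f x \<le> t" using A(2) by auto
    then show "max_comp f x \<le> max_comp id t"
      unfolding max_comp_le_iff less_eq_vec_def
      using comp_le_max_comp[of id t] order_trans by fastforce
  qed
  ultimately show thesis using that bounded_subset by blast
qed

lemma T_inf_nonempty:
  fixes f :: "real ^ 'n \<Rightarrow> real ^ 'm"
  assumes diff: "\<And>x. f differentiable (at x)"
    and sec: "\<forall>t. bounded_section_at (range f) t" and "\<not> is_proper f"
  shows "T_inf f \<noteq> {}"
proof -
  have cont: "continuous_on UNIV f"
    by (simp add: continuous_at_imp_continuous_on diff differentiable_imp_continuous_within)
  from unbounded_sublevel_of_not_proper[OF cont assms(3)]
  obtain s where s: "\<not> bounded {x. max_comp f x \<le> s}" .
  have "\<exists>y. y \<in> tangency_variety f \<and> real k \<le> norm y \<and> max_comp f y \<le> s" for k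
  proof -
    obtain x where x: "max_comp f x \<le> s" "real k + 1 < norm x"
      using s by (auto simp: bounded_iff not_le)
    have "continuous_on (sphere 0 (norm x)) (max_comp f)"
      using continuous_on_max_comp[OF cont] continuous_on_subset by blast
    moreover have "x \<in> sphere 0 (norm x)" by simp
    ultimately obtain y where "y \<in> sphere 0 (norm x)"
      "\<And>z. z \<in> sphere 0 (norm x) \<Longrightarrow> max_comp f y \<le> max_comp f z"
      using continuous_attains_inf[OF compact_sphere] by (metis empty_iff)
    then have y: "norm y = norm x" "\<And>z. norm z = norm x \<Longrightarrow> max_comp f y \<le> max_comp f z"
      by auto
    then have "y \<noteq> 0" using x(2) by auto
    then have "y \<in> tangency_variety f"
      using sphere_min_in_tangency_variety[OF diff] y by metis
    moreover have "max_comp f y \<le> s" using y(2)[of x] x(1) by simp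
    ultimately show ?thesis using y(1) x(2) by auto
  qed
  then obtain X where X: "\<And>k. X k \<in> tangency_variety f" "\<And>k. real k \<le> norm (X k)"
    "\<And>k. max_comp f (X k) \<le> s"
    by metis
  obtain r t where "strict_mono r" "(\<lambda>k. f (X (r k))) \<longlonglongrightarrow> t"
    by (rule convergent_subsequence_of_bounded_max_comp[OF sec X(3)])
  then have "t \<in> T_inf f"
    unfolding T_inf_def using X(1) filterlim_subseq_of_norm_ge[OF X(2)]
    by (auto intro!: exI[of _ "\<lambda>k. X (r k)"])
  then show ?thesis by auto
qed

section \<open>Almost critical points at infinity\<close>

text \<open>A penalised minimisation on a ball, in the spirit of Ekeland's principle. The constant
  is 3 times 6: the minimiser has norm at most 3\<rho>, and the penalty has gradient of norm at most
  6\<epsilon>/\<rho> on the ball.\<close>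

lemma almost_critical_point_far_out:
  fixes f :: "real ^ 'n \<Rightarrow> real ^ 'm"
  assumes diff: "\<And>x. f differentiable (at x)"
    and low: "bounded {x. max_comp f x \<le> \<alpha> - \<epsilon>}"
    and high: "\<not> bounded {x. max_comp f x \<le> \<alpha> + \<epsilon>}" and "0 < \<epsilon>"
  obtains y where "R \<le> norm y" "max_comp f y \<le> \<alpha> + \<epsilon>" "norm y * rabier f y \<le> 18 * \<epsilon>"
proof -
  have cont: "continuous_on UNIV f"
    by (simp add: continuous_at_imp_continuous_on diff differentiable_imp_continuous_within)
  obtain M where M: "\<And>x. max_comp f x \<le> \<alpha> - \<epsilon> \<Longrightarrow> norm x \<le> M"
    using low by (auto simp: bounded_iff)
  \<comment> \<open>Half the norm of \<open>x\<close> must exceed \<open>M\<close> and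
    \<open>R\<close> and be positive, since it becomes the radius of the ball.\<close>
  obtain x where x: "max_comp f x \<le> \<alpha> + \<epsilon>" "2 * (\<bar>M\<bar> + \<bar>R\<bar> + 1) < norm x"
    using high by (auto simp: bounded_iff not_le)
  define \<rho> where "\<rho> = norm x / 2"
  have \<rho>: "0 < \<rho>" "M < \<rho>" "R \<le> \<rho>" using x(2) by (auto simp: \<rho>_def)
  \<comment> \<open>The penalty equals \<open>3\<epsilon>\<close> on the boundary of the ball, more than the oscillation \<open>2\<epsilon>\<close> to beat.\<close>
  define q where "q y = 3 * \<epsilon> / \<rho>\<^sup>2 * ((y - x) \<bullet> (y - x))" for y
  \<comment> \<open>The centre has norm 2\<rho>, so the ball stays in the annulus between radii
    \<rho> and 3\<rho>, outside the region where values up to \<alpha> - \<epsilon> occur.\<close>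
  have norm_ball: "\<rho> \<le> norm y" "norm y \<le> 3 * \<rho>" if "dist y x \<le> \<rho>" for y
    using that norm_triangle_ineq2[of x y] norm_triangle_ineq2[of y x]
    by (auto simp: \<rho>_def dist_norm norm_minus_commute)
  have "continuous_on (cball x \<rho>) (\<lambda>y. max_comp f y + q y)"
    unfolding q_def
    by (intro continuous_intros continuous_on_subset[OF continuous_on_max_comp[OF cont]]) auto
  moreover have "x \<in> cball x \<rho>" using \<rho> by simp
  ultimately obtain y where "y \<in> cball x \<rho>"
    "\<And>z. z \<in> cball x \<rho> \<Longrightarrow> max_comp f y + q y \<le> max_comp f z + q z"
    using continuous_attains_inf[OF compact_cball, of x \<rho>] by blast
  then have y: "dist y x \<le> \<rho>" "\<And>z. dist z x \<le> \<rho> \<Longrightarrow> max_comp f y + q y \<le> max_comp f z + q z"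
    by (auto simp: dist_commute)
  \<comment> \<open>The penalty vanishes at \<open>x\<close>, which bounds the penalised minimum;
    the lower bound on \<open>max_comp f y\<close> then leaves less than 2\<epsilon> for the
    penalty.\<close>
  have "max_comp f y + q y \<le> \<alpha> + \<epsilon>"
    using y(2)[of x] x(1) \<rho>(1) by (simp add: q_def)
  moreover have "\<alpha> - \<epsilon> < max_comp f y"
    using M[of y] norm_ball(1)[OF y(1)] \<rho>(2) by linarith
  moreover have "0 \<le> q y" using \<open>0 < \<epsilon>\<close> by (simp add: q_def)
  ultimately have y_le: "max_comp f y \<le> \<alpha> + \<epsilon>" and "q y < 2 * \<epsilon>" by auto
  have "dist y x < \<rho>"
  proof (rule ccontr)
    assume "\<not> dist y x < \<rho>"
    then have "norm (y - x) = \<rho>" using y(1) by (simp add: dist_norm)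
    then have "q y = 3 * \<epsilon>" using \<rho>(1) by (simp add: q_def dot_square_norm)
    then show False using \<open>q y < 2 * \<epsilon>\<close> \<open>0 < \<epsilon>\<close> by simp
  qed
  define p where "p = (6 * \<epsilon> / \<rho>\<^sup>2) *\<^sub>R (y - x)"
  have "GDERIV (\<lambda>z. a * ((z - x) \<bullet> (z - x))) y :> (2 * a) *\<^sub>R (y - x)" for a
    unfolding gderiv_def
    by (auto intro!: derivative_eq_intros simp: inner_commute algebra_simps)
  from this[of "3 * \<epsilon> / \<rho>\<^sup>2"] have "GDERIV q y :> p"
    by (simp add: q_def[abs_def] p_def)
  then have "rabier f y \<le> norm p"
  proof (rule rabier_le_penalty[OF diff])
    show "0 < \<rho> - dist y x" using \<open>dist y x < \<rho>\<close> by simp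
    fix z assume "dist z y < \<rho> - dist y x"
    then have "dist z x \<le> \<rho>" using dist_triangle[of z x y] by linarith
    then show "max_comp f y + q y \<le> max_comp f z + q z" by (rule y(2))
  qed
  also have "norm p \<le> (6 * \<epsilon> / \<rho>\<^sup>2) * \<rho>"
    using y(1) \<open>0 < \<epsilon>\<close> by (simp add: p_def dist_norm divide_right_mono)
  also have "\<dots> = 6 * \<epsilon> / \<rho>" using \<rho>(1) by (simp add: power2_eq_square)
  finally have "norm y * rabier f y \<le> (3 * \<rho>) * (6 * \<epsilon> / \<rho>)"
    using norm_ball(2)[OF y(1)] \<rho>(1) by (intro mult_mono rabier_nonneg) auto
  then have "norm y * rabier f y \<le> 18 * \<epsilon>" using \<rho>(1) by simp
  moreover have "R \<le> norm y" using norm_ball(1)[OF y(1)] \<rho>(3) by simp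
  ultimately show thesis using that y_le by blast
qed

text \<open>At the critical level \<alpha>, sublevel sets are bounded just below and unbounded just
  above, so the preceding lemma applies with every positive \<epsilon>; letting \<epsilon> tend to 0
  yields the sequence.\<close>

lemma K_inf_nonempty:
  fixes f :: "real ^ 'n \<Rightarrow> real ^ 'm"
  assumes diff: "\<And>x. f differentiable (at x)"
    and sec: "\<forall>t. bounded_section_at (range f) t" and "\<not> is_proper f"
  shows "K_inf f \<noteq> {}"
proof -
  have cont: "continuous_on UNIV f"
    by (simp add: continuous_at_imp_continuous_on diff differentiable_imp_continuous_within)
  define S where "S = {s. \<not> bounded {x. max_comp f x \<le> s}}"
  from unbounded_sublevel_of_not_proper[OF cont assms(3)]
  have "S \<noteq> {}" by (auto simp: S_def)
  define \<alpha> where "\<alpha> = Inf S"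
  have "bdd_below S"
  proof -
    obtain a where a: "\<And>x. f x \<le> 0 \<Longrightarrow> a \<le> f x"
      using sec by (auto simp: bounded_section_at_iff)
    \<comment> \<open>Either \<open>f x \<le> 0\<close>, and the section at 0 bounds an arbitrarily
      fixed component below, or some component is positive.\<close>
    define b where "b = min 0 (a $ undefined)"
    have "b \<le> max_comp f x" for x
    proof (cases "f x \<le> 0")
      case True
      then have "a $ undefined \<le> f x $ undefined" using a by (simp add: less_eq_vec_def)
      then show ?thesis using comp_le_max_comp[of f x undefined] by (simp add: b_def)
    next
      case False
      then obtain i where "0 < f x $ i" by (auto simp: less_eq_vec_def not_le)
      then show ?thesis using comp_le_max_comp[of f x i] by (simp add: b_def)
    qed
    then have "{x. max_comp f x \<le> s} = {}" if "s < b" for s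
      using that by (smt (verit, best) empty_Collect_eq)
    then have "b \<le> s" if "s \<in> S" for s
      using that by (force simp: S_def not_le[symmetric])
    then show ?thesis by (rule bdd_belowI)
  qed
  have low: "bounded {x. max_comp f x \<le> \<alpha> - \<epsilon>}" if "0 < \<epsilon>" for \<epsilon>
    using cInf_lower[OF _ \<open>bdd_below S\<close>, of "\<alpha> - \<epsilon>"] that by (auto simp: S_def \<alpha>_def)
  have high: "\<not> bounded {x. max_comp f x \<le> \<alpha> + \<epsilon>}" if pos: "0 < \<epsilon>" for \<epsilon>
  proof -
    obtain s where "s \<in> S" "s < \<alpha> + \<epsilon>"
      using cInf_lessD[OF \<open>S \<noteq> {}\<close>, of "\<alpha> + \<epsilon>"] pos by (auto simp: \<alpha>_def)
    moreover from this have "{x. max_comp f x \<le> s} \<subseteq> {x. max_comp f x \<le> \<alpha> + \<epsilon>}" by auto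
    ultimately show ?thesis using bounded_subset by (auto simp: S_def)
  qed
  have "\<exists>y. real k \<le> norm y \<and> max_comp f y \<le> \<alpha> + inverse (real (Suc k)) \<and>
      norm y * rabier f y \<le> 18 * inverse (real (Suc k))" for k
    by (rule almost_critical_point_far_out[OF diff low high, of "inverse (real (Suc k))" "real k"])
      auto
  then obtain X where X: "\<And>k. real k \<le> norm (X k)"
    "\<And>k. max_comp f (X k) \<le> \<alpha> + inverse (real (Suc k))"
    "\<And>k. norm (X k) * rabier f (X k) \<le> 18 * inverse (real (Suc k))"
    by metis
  \<comment> \<open>One common level is needed to extract a convergent subsequence of
    values.\<close>
  have X_le: "max_comp f (X k) \<le> \<alpha> + 1" for k
    using X(2)[of k] inverse_le_1_iff[of "real (Suc k)"] by simp
  obtain r t where rt: "strict_mono r" "(\<lambda>k. f (X (r k))) \<longlonglongrightarrow> t"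
    by (rule convergent_subsequence_of_bounded_max_comp[OF sec X_le])
  have "(\<lambda>k. 18 * inverse (real (Suc k))) \<longlonglongrightarrow> 0"
    using tendsto_mult_right_zero[OF LIMSEQ_inverse_real_of_nat] .
  then have "(\<lambda>k. norm (X k) * rabier f (X k)) \<longlonglongrightarrow> 0"
    by (rule tendsto_sandwich[OF always_eventually always_eventually tendsto_const, rotated 2])
      (use X(3) in \<open>auto intro: mult_nonneg_nonneg rabier_nonneg\<close>)
  from LIMSEQ_subseq_LIMSEQ[OF this rt(1)]
  have "t \<in> K_inf f"
    unfolding K_inf_def using rt filterlim_subseq_of_norm_ge[OF X(1)]
    by (auto intro!: exI[of _ "\<lambda>k. X (r k)"] simp: o_def)
  then show ?thesis by auto
qed

theorem corollary4p1:
  fixes f :: "real ^ 'n \<Rightarrow> real ^ 'm"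
  assumes "polynomial_function f"
    and "\<forall>t. bounded_section_at (range f) t"
  shows "(is_proper f \<longleftrightarrow> palais_smale f) \<and>
         (is_proper f \<longleftrightarrow> weak_palais_smale f) \<and>
         (is_proper f \<longleftrightarrow> M_tame f) \<and>
         (is_proper f \<or> palais_smale f \<or> weak_palais_smale f \<or> M_tame f
            \<longrightarrow> (\<exists>x. pareto_solution f x))"
proof -
  have diff: "f differentiable (at x)" for x
    using assms(1) by (rule differentiable_at_polynomial_function)
  have "is_proper f \<longleftrightarrow> weak_palais_smale f"
    unfolding weak_palais_smale_def
    using K_inf_nonempty[OF diff assms(2)] proper_imp_no_asymptotic_values by blast
  moreover have "is_proper f \<longleftrightarrow> palais_smale f"
    \<comment> \<open>If the larger set \<open>K_tilde_inf f\<close> is empty, so is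
      \<open>K_inf f\<close>; hence the same nonemptiness result settles both Palais-Smale
      conditions.\<close>
    unfolding palais_smale_def
    using K_inf_nonempty[OF diff assms(2)] K_inf_subset_K_tilde_inf
      proper_imp_no_asymptotic_values by blast
  moreover have "is_proper f \<longleftrightarrow> M_tame f"
    unfolding M_tame_def
    using T_inf_nonempty[OF diff assms(2)] proper_imp_no_asymptotic_values by blast
  moreover have "\<exists>x. pareto_solution f x" if "is_proper f"
    using proper_ex_pareto_solution[OF that continuous_on_polymonial_function[OF assms(1)] assms(2)] .
  ultimately show ?thesis by blast
qed

end
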